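(* The algebra $\mathcal{A}$ has a presentation involving generators $x,y$ and relations $$x^{2}y+2xyx+yx^{2}=4y,\qquad y^{2}x+2yxy+xy^{2}=4x.$$ That is, if $\mathcal{B}$ denotes the unital associative $\mathbb{K}$-algebra with generators $X,Y$ and relations $X^2Y+2XYX+YX^2=4Y$, $Y^2X+2YXY+XY^2=4X$, then there is a $\mathbb{K}$-algebra isomorphism $\mathcal{B}\to\mathcal{A}$ sending $X\mapsto x$ and $Y\mapsto y$.
   Context: $\mathbb{K}$ is an algebraically closed field of characteristic zero. $\mathcal{A}$ is the unital associative $\mathbb{K}$-algebra with generators $x,y,z$ and relations $xy+yx=2z$, $yz+zy=2x$, $zx+xz=2y$. *)

theory Defs
  imports
    "HOL-Algebra.QuotRing"
    "HOL-Algebra.Module"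
    "HOL-Computational_Algebra.Polynomial"
    "HOL-Library.Poly_Mapping"
begin

section \<open>Free associative algebras\<close>

text \<open>The free monoid is a copy of the list type, so that lists themselves do not acquire an
  instance of \<^class>\<open>monoid_add\<close>.\<close>

datatype 'x word = Word (letters: "'x list")

instantiation word :: (type) monoid_add
begin

definition zero_word :: "'a word"
  where "0 = Word []"

definition plus_word :: "'a word \<Rightarrow> 'a word \<Rightarrow> 'a word"
  where "u + v = Word (letters u @ letters v)"

instance
  by standard (simp_all add: zero_word_def plus_word_def)

end

text \<open>The monoid algebra of the free monoid: finitely supported functions on words, whose product
  in \<^class>\<open>ring_1\<close> is convolution. The numerals in it are the scalar multiples of the unit.\<close>

type_synonym ('k, 'x) noncomm_poly = "'x word \<Rightarrow>\<^sub>0 'k"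

definition var :: "'x \<Rightarrow> ('k::field, 'x) noncomm_poly"
  where "var a = Poly_Mapping.single (Word [a]) 1"

definition free_algebra :: "('k::field, ('k, 'x) noncomm_poly) module"
  where "free_algebra =
    \<lparr>carrier = UNIV, monoid.mult = (*), one = 1, ring.zero = 0, add = (+),
     module.smult = (\<lambda>c. Poly_Mapping.map ((*) c))\<rparr>"

lemma ring_free_algebra: "ring (free_algebra :: ('k::field, ('k, 'x) noncomm_poly) module)"
proof (rule ringI)
  show "abelian_group (free_algebra :: ('k, ('k, 'x) noncomm_poly) module)"
    by (rule abelian_groupI)
      (auto simp: free_algebra_def ac_simps intro: exI [of _ "- x" for x] add.left_inverse)
  show "monoid (free_algebra :: ('k, ('k, 'x) noncomm_poly) module)"
    by (rule monoidI) (auto simp: free_algebra_def ac_simps)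
qed (auto simp: free_algebra_def algebra_simps)


section \<open>Algebras given by generators and relations\<close>

text \<open>The scalar multiplication on cosets is lifted in the same way as the product
  \<^const>\<open>rcoset_mult\<close> of \<^const>\<open>FactRing\<close>. The ideals of HOL-Algebra are two-sided.\<close>

definition quotient_algebra :: "('k, 'a) module \<Rightarrow> 'a set \<Rightarrow> ('k, 'a set) module"
  where "quotient_algebra A I =
    ring.extend (A Quot I) (module.fields (\<lambda>c U. \<Union>u\<in>U. I +>\<^bsub>A\<^esub> (c \<odot>\<^bsub>A\<^esub> u)))"

text \<open>A relation \<open>l = r\<close> is represented by the element \<open>l - r\<close> of the free algebra.\<close>

definition presented_algebra ::
    "('k::field, 'x) noncomm_poly set \<Rightarrow> ('k, ('k, 'x) noncomm_poly set) module"
  where "presented_algebra S = quotient_algebra free_algebra (Idl\<^bsub>free_algebra\<^esub> S)"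

definition presented_gen ::
    "('k::field, 'x) noncomm_poly set \<Rightarrow> 'x \<Rightarrow> ('k, 'x) noncomm_poly set"
  where "presented_gen S a = Idl\<^bsub>free_algebra\<^esub> S +>\<^bsub>free_algebra\<^esub> var a"

lemma ideal_relations: "ideal (Idl\<^bsub>free_algebra\<^esub> S) (free_algebra :: ('k::field, _) module)"
  by (rule ring.genideal_ideal [OF ring_free_algebra]) (simp add: free_algebra_def)

lemma ring_extend:
  fixes R :: "'a ring"
  assumes "ring R"
  shows "ring (ring.extend R f)"
proof -
  interpret ring R by fact
  show ?thesis
  proof (intro ringI abelian_groupI monoidI)
    fix x assume "x \<in> carrier (ring.extend R f)"
    then show "\<exists>y\<in>carrier (ring.extend R f).
        y \<oplus>\<^bsub>ring.extend R f\<^esub> x = \<zero>\<^bsub>ring.extend R f\<^esub>"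
      using l_neg [of x] a_inv_closed [of x] by (auto simp only: ring.defs partial_object.simps monoid.simps ring.simps)
  next
    fix x y assume "x \<in> carrier (ring.extend R f)" "y \<in> carrier (ring.extend R f)"
    then show "x \<oplus>\<^bsub>ring.extend R f\<^esub> y = y \<oplus>\<^bsub>ring.extend R f\<^esub> x"
     by (simp add: ring.defs a_comm)
  qed (simp_all add: ring.defs m_assoc a_assoc l_distr r_distr)
qed

lemma ring_presented_algebra: "ring (presented_algebra S)"
  unfolding presented_algebra_def quotient_algebra_def
  by (intro ring_extend ideal.quotient_is_ring [OF ideal_relations])

lemma smult_free_algebra: "c \<odot>\<^bsub>free_algebra\<^esub> p = Poly_Mapping.single 0 c * p"
  by (simp add: free_algebra_def mult_map_scale_conv_mult)

lemma smult_presented_algebra: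
  fixes S :: "('k::field, 'x) noncomm_poly set"
  defines "I \<equiv> Idl\<^bsub>free_algebra\<^esub> S"
  shows "c \<odot>\<^bsub>presented_algebra S\<^esub> (I +>\<^bsub>free_algebra\<^esub> p) =
    I +>\<^bsub>free_algebra\<^esub> (c \<odot>\<^bsub>free_algebra\<^esub> p)"
proof -
  interpret ideal I "free_algebra :: ('k, ('k, 'x) noncomm_poly) module"
    unfolding I_def by (rule ideal_relations)
  have eq: "I +>\<^bsub>free_algebra\<^esub> (c \<odot>\<^bsub>free_algebra\<^esub> u) =
      I +>\<^bsub>free_algebra\<^esub> (c \<odot>\<^bsub>free_algebra\<^esub> p)"
    if "u \<in> I +>\<^bsub>free_algebra\<^esub> p" for u
  proof -
    from that obtain i where i: "i \<in> I" "u = i + p"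
      by (auto simp: a_r_coset_def r_coset_def free_algebra_def)
    have "c \<odot>\<^bsub>free_algebra\<^esub> i \<in> I"
      using I_l_closed [OF i(1), of "Poly_Mapping.single 0 c"]
      by (simp add: smult_free_algebra) (simp add: free_algebra_def)
    moreover have "c \<odot>\<^bsub>free_algebra\<^esub> u =
        c \<odot>\<^bsub>free_algebra\<^esub> i \<oplus>\<^bsub>free_algebra\<^esub> c \<odot>\<^bsub>free_algebra\<^esub> p"
      by (simp add: smult_free_algebra i(2) distrib_left) (simp add: free_algebra_def)
    ultimately have "c \<odot>\<^bsub>free_algebra\<^esub> u \<in> I +>\<^bsub>free_algebra\<^esub> (c \<odot>\<^bsub>free_algebra\<^esub> p)"
      by (auto simp: a_r_coset_def r_coset_def)
    then show ?thesis
      by (intro a_repr_independence' [THEN sym]) (simp_all add: free_algebra_def)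
  qed
  have "p \<in> I +>\<^bsub>free_algebra\<^esub> p"
    by (rule a_rcos_self) (simp add: free_algebra_def)
  then have "(\<Union>u\<in>I +>\<^bsub>free_algebra\<^esub> p. I +>\<^bsub>free_algebra\<^esub> (c \<odot>\<^bsub>free_algebra\<^esub> u)) =
      I +>\<^bsub>free_algebra\<^esub> (c \<odot>\<^bsub>free_algebra\<^esub> p)"
    using eq by blast
  then show ?thesis
    by (simp add: presented_algebra_def quotient_algebra_def ring.defs module.defs I_def)
qed

text \<open>Homomorphisms of unital algebras over all of the scalar type \<open>'k\<close>;
  \<^const>\<open>ring_hom\<close> includes preservation of the unit.\<close>

definition algebra_hom :: "('k, 'a) module \<Rightarrow> ('k, 'b) module \<Rightarrow> ('a \<Rightarrow> 'b) set"
  where "algebra_hom A B =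
    {h \<in> ring_hom A B. \<forall>c. \<forall>a\<in>carrier A. h (c \<odot>\<^bsub>A\<^esub> a) = c \<odot>\<^bsub>B\<^esub> h a}"

definition algebra_iso :: "('k, 'a) module \<Rightarrow> ('k, 'b) module \<Rightarrow> ('a \<Rightarrow> 'b) set"
  where "algebra_iso A B = {h \<in> algebra_hom A B. bij_betw h (carrier A) (carrier B)}"


section \<open>The two presentations\<close>

datatype gen_xyz = Gx | Gy | Gz

datatype gen_XY = GX | GY

definition relations_A :: "('k::field, gen_xyz) noncomm_poly set"
  where "relations_A =
    (let x = var Gx; y = var Gy; z = var Gz
     in {x * y + y * x - 2 * z,
         y * z + z * y - 2 * x,
         z * x + x * z - 2 * y})"

definition relations_B :: "('k::field, gen_XY) noncomm_poly set"
  where "relations_B =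
    (let X = var GX; Y = var GY
     in {X\<^sup>2 * Y + 2 * X * Y * X + Y * X\<^sup>2 - 4 * Y,
         Y\<^sup>2 * X + 2 * Y * X * Y + X * Y\<^sup>2 - 4 * X})"

definition algebra_A :: "('k::field, ('k, gen_xyz) noncomm_poly set) module"
  where "algebra_A = presented_algebra relations_A"

definition algebra_B :: "('k::field, ('k, gen_XY) noncomm_poly set) module"
  where "algebra_B = presented_algebra relations_B"

end

theory Submission
  imports Defs
begin

text \<open>In \<open>\<A>\<close> the first relation expresses \<open>z\<close> as \<open>(xy + yx)/2\<close>. Substituting this
  into the two other relations turns them into half the relations of \<open>\<B>\<close>; conversely, each
  relation of \<open>\<B>\<close> is a two-sided combination of the relations of \<open>\<A>\<close>. Hence the substitutions
  \<open>X \<mapsto> x\<close>, \<open>Y \<mapsto> y\<close> and \<open>x \<mapsto> X\<close>, \<open>y \<mapsto> Y\<close>, \<open>z \<mapsto> (XY + YX)/2\<close> descend to the quotients,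
  where they are mutually inverse because they are so on generators.\<close>

section \<open>Scalars, monomials and induction in the free algebra\<close>

abbreviation scalar :: "'k::field \<Rightarrow> ('k, 'x) noncomm_poly"
  where "scalar \<equiv> Poly_Mapping.single 0"

lemma single_induct [case_names single add]:
  fixes p :: "'a \<Rightarrow>\<^sub>0 'b::comm_monoid_add"
  assumes single: "\<And>w c. P (Poly_Mapping.single w c)"
    and add: "\<And>p q. P p \<Longrightarrow> P q \<Longrightarrow> P (p + q)"
  shows "P p"
proof (induction p rule: update_induct)
  case const
  \<comment> \<open>Zero counts as a monomial with coefficient 0, at an arbitrary index.\<close>
  show ?case using single [of undefined 0] by simp
next
  case (update p w c)
  \<comment> \<open>As \<open>w\<close> lies outside the support of \<open>p\<close>, overwriting
    its coefficient amounts to adding a monomial.\<close>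
  have "Poly_Mapping.update w c p = p + Poly_Mapping.single w c"
    using update(1)
    by (intro poly_mapping_eqI)
      (auto simp: lookup_update lookup_add lookup_single in_keys_iff when_def)
  then show ?case using update(3) add single by metis
qed

text \<open>Scalars sit at the empty word, which is neutral for concatenation, and \<open>'k\<close>
  is commutative.\<close>

lemma scalar_commute: "scalar c * p = p * (scalar c :: ('k::field, 'x) noncomm_poly)"
  by (induction p rule: single_induct) (simp_all add: mult_single mult.commute [of c] distrib_left distrib_right)

lemma scalar_left_commute: "p * (scalar c * q) = scalar c * (p * (q :: ('k::field, 'x) noncomm_poly))"
  using scalar_commute [of c p] by (simp flip: mult.assoc)

lemma single_eq_scalar_mult_vars:
  fixes c :: "'k::field" and w :: "'x word"
  shows "Poly_Mapping.single w c = scalar c * prod_list (map var (letters w))"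
proof -
  have "Poly_Mapping.single (Word xs) (1::'k) = prod_list (map var xs)" for xs :: "'x list"
  proof (induction xs)
    case Nil
    show ?case by (simp flip: zero_word_def)
  next
    case (Cons a xs)
    have "Poly_Mapping.single (Word (a # xs)) (1::'k) = var a * Poly_Mapping.single (Word xs) 1"
      by (simp add: var_def mult_single plus_word_def)
    then show ?case using Cons by simp
  qed
  from this [of "letters w", symmetric] show ?thesis
    by (simp add: mult_single)
qed

text \<open>Scalars and variables generate the free algebra as a ring, since each monomial is a
  scalar times a product of variables.\<close>

lemma noncomm_poly_induct [case_names scalar var add mult]:
  fixes p :: "('k::field, 'x) noncomm_poly"
  assumes scalar: "\<And>c. P (scalar c)" and var: "\<And>a. P (var a)"
    and add: "\<And>p q. P p \<Longrightarrow> P q \<Longrightarrow> P (p + q)"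
    and mult: "\<And>p q. P p \<Longrightarrow> P q \<Longrightarrow> P (p * q)"
  shows "P p"
proof (induction p rule: single_induct)
  case (single w c)
  have "P (prod_list (map var xs))" for xs
  proof (induction xs)
    case Nil
    show ?case using scalar [of 1] by simp
  qed (simp add: var mult)
  then show ?case by (simp only: single_eq_scalar_mult_vars [of w] scalar mult)
qed (rule add)

section \<open>Substitution: the homomorphism given by the universal property of the free
  algebra\<close>

definition subst :: "('x \<Rightarrow> ('k::field, 'y) noncomm_poly) \<Rightarrow> ('k, 'x) noncomm_poly \<Rightarrow> ('k, 'y) noncomm_poly"
  where "subst \<phi> p =
    (\<Sum>w\<in>Poly_Mapping.keys p. scalar (Poly_Mapping.lookup p w) * prod_list (map \<phi> (letters w)))"

text \<open>Cancellation may shrink the support of a sum; this does no harm, because each term is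
  additive in the coefficient and vanishes at 0.\<close>

lemma subst_add [simp]: "subst \<phi> (p + q) = subst \<phi> p + subst \<phi> q"
  unfolding subst_def by (rule setsum_keys_plus_distrib) (simp_all add: single_add algebra_simps)

lemma subst_single: "subst \<phi> (Poly_Mapping.single w c) = scalar c * prod_list (map \<phi> (letters w))"
  by (cases "c = 0") (simp_all add: subst_def)

lemma subst_scalar [simp]: "subst \<phi> (scalar c) = scalar c"
  by (simp add: subst_single zero_word_def)

lemma subst_var [simp]: "subst \<phi> (var a) = \<phi> a"
  by (simp add: subst_single var_def)

lemma subst_one [simp]: "subst \<phi> 1 = 1"
  using subst_scalar [of \<phi> 1] by simp

lemma subst_numeral [simp]: "subst \<phi> (numeral n) = numeral n"
  using subst_scalar [of \<phi> "numeral n"] by simp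

lemma subst_diff [simp]: "subst \<phi> (p - q) = subst \<phi> p - subst \<phi> q"
  using subst_add [of \<phi> "p - q" q] by (simp add: eq_diff_eq)

text \<open>Both sides are biadditive, so monomials suffice. There the words concatenate, and the
  second scalar moves past the first word because it is central.\<close>

lemma subst_mult [simp]:
  fixes \<phi> :: "'x \<Rightarrow> ('k::field, 'y) noncomm_poly"
  shows "subst \<phi> (p * q) = subst \<phi> p * subst \<phi> q"
proof (induction p rule: single_induct)
  case (single v c)
  show ?case
  proof (induction q rule: single_induct)
    case (single w d)
    have "letters (v + w) = letters v @ letters w"
      by (simp add: plus_word_def)
    moreover have "scalar (c * d) = scalar c * (scalar d :: ('k, 'y) noncomm_poly)"
      by (simp add: mult_single)
    ultimately show ?case
      by (simp add: mult_single [of v] subst_single mult.assoc scalar_left_commute [of "prod_list _"])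
  qed (simp add: distrib_left)
qed (simp add: distrib_right)

section \<open>Relation ideals, their cosets, and maps between the quotients\<close>

abbreviation relation_ideal :: "('k::field, 'x) noncomm_poly set \<Rightarrow> ('k, 'x) noncomm_poly set"
  where "relation_ideal S \<equiv> Idl\<^bsub>free_algebra\<^esub> S"

abbreviation presented_class ::
    "('k::field, 'x) noncomm_poly set \<Rightarrow> ('k, 'x) noncomm_poly \<Rightarrow> ('k, 'x) noncomm_poly set"
  where "presented_class S p \<equiv> relation_ideal S +>\<^bsub>free_algebra\<^esub> p"

lemma free_algebra_simps [simp]:
  "carrier free_algebra = UNIV"
  "p \<otimes>\<^bsub>free_algebra\<^esub> q = p * q"
  "p \<oplus>\<^bsub>free_algebra\<^esub> q = p + q"
  "\<one>\<^bsub>free_algebra\<^esub> = 1"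
  "\<zero>\<^bsub>free_algebra\<^esub> = 0"
  by (simp_all add: free_algebra_def)

context
  fixes S :: "('k::field, 'x) noncomm_poly set"
begin

interpretation I: ideal "relation_ideal S" "free_algebra :: ('k, ('k, 'x) noncomm_poly) module"
  by (rule ideal_relations)

lemma relation_ideal_self: "S \<subseteq> relation_ideal S"
  by (rule I.genideal_self) simp

lemma relation_ideal_add: "p \<in> relation_ideal S \<Longrightarrow> q \<in> relation_ideal S \<Longrightarrow> p + q \<in> relation_ideal S"
  using additive_subgroup.a_closed [OF I.additive_subgroup_axioms, of p q] by simp

lemma relation_ideal_lmult: "p \<in> relation_ideal S \<Longrightarrow> q * p \<in> relation_ideal S"
  using I.I_l_closed by simp

lemma relation_ideal_rmult: "p \<in> relation_ideal S \<Longrightarrow> p * q \<in> relation_ideal S"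
  using I.I_r_closed by simp

lemma relation_ideal_zero: "0 \<in> relation_ideal S"
  using additive_subgroup.zero_closed [OF I.additive_subgroup_axioms] by simp

text \<open>Cosets that meet coincide. Through this, well-definedness and inverse laws on quotients
  become ideal memberships.\<close>

lemma presented_class_eq_iff: "presented_class S p = presented_class S q \<longleftrightarrow> p - q \<in> relation_ideal S"
proof -
  have "presented_class S p = presented_class S q \<longleftrightarrow> p \<in> presented_class S q"
    using I.a_repr_independence' [of p q] I.a_rcos_self [of p] by auto
  also have "\<dots> \<longleftrightarrow> p - q \<in> relation_ideal S"
    by (force simp: a_r_coset_def r_coset_def diff_eq_eq)
  finally show ?thesis .
qed

lemma carrier_presented_algebra: "carrier (presented_algebra S) = range (presented_class S)"
  by (auto simp: presented_algebra_def quotient_algebra_def ring.defs FactRing_def A_RCOSETS_def')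

lemma mult_presented_algebra:
  "presented_class S p \<otimes>\<^bsub>presented_algebra S\<^esub> presented_class S q = presented_class S (p * q)"
  using I.rcoset_mult_add [of p q]
  by (simp add: presented_algebra_def quotient_algebra_def ring.defs FactRing_def)

lemma add_presented_algebra:
  "presented_class S p \<oplus>\<^bsub>presented_algebra S\<^esub> presented_class S q = presented_class S (p + q)"
  using I.a_rcos_sum [of p q]
  by (simp add: presented_algebra_def quotient_algebra_def ring.defs FactRing_def)

lemma one_presented_algebra: "\<one>\<^bsub>presented_algebra S\<^esub> = presented_class S 1"
  by (simp add: presented_algebra_def quotient_algebra_def ring.defs FactRing_def)

end

text \<open>The preimage of an ideal under a ring homomorphism is an ideal. Here it contains
  \<open>S\<close>, hence the ideal generated by \<open>S\<close>.\<close>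

lemma subst_relation_ideal:
  assumes "\<And>r. r \<in> S \<Longrightarrow> subst \<phi> r \<in> relation_ideal T" and "p \<in> relation_ideal S"
  shows "subst \<phi> p \<in> relation_ideal T"
proof -
  have "ring_hom_ring free_algebra free_algebra (subst \<phi>)"
    by (intro ring_hom_ringI ring_free_algebra) simp_all
  then have "ideal {p \<in> carrier free_algebra. subst \<phi> p \<in> relation_ideal T} free_algebra"
    by (rule ring_hom_ring.ideal_vimage) (rule ideal_relations)
  then have "relation_ideal S \<subseteq> {p \<in> carrier free_algebra. subst \<phi> p \<in> relation_ideal T}"
    by (rule ring.genideal_minimal [OF ring_free_algebra]) (use assms(1) in auto)
  then show ?thesis using assms(2) by auto
qed

text \<open>Modulo the ideal, both sides respect sums and products and agree on scalars, so
  agreement on variables propagates to every \<open>p\<close>.\<close>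

lemma subst_subst_class:
  assumes "\<And>a. subst \<psi> (\<phi> a) - var a \<in> relation_ideal S"
  shows "presented_class S (subst \<psi> (subst \<phi> p)) = presented_class S p"
proof (induction p rule: noncomm_poly_induct)
  case (var a)
  show ?case using assms by (simp add: presented_class_eq_iff)
next
  case (add p q)
  then show ?case by (simp flip: add_presented_algebra)
next
  case (mult p q)
  then show ?case by (simp flip: mult_presented_algebra)
qed simp

text \<open>The hypotheses concern only relations and generators: the first two let the
  substitutions descend to the quotients, the last two make the descended maps mutually
  inverse.\<close>

lemma presented_algebra_iso:
  assumes \<phi>: "\<And>r. r \<in> S \<Longrightarrow> subst \<phi> r \<in> relation_ideal T"
    and \<psi>: "\<And>r. r \<in> T \<Longrightarrow> subst \<psi> r \<in> relation_ideal S"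
    and \<psi>\<phi>: "\<And>a. subst \<psi> (\<phi> a) - var a \<in> relation_ideal S"
    and \<phi>\<psi>: "\<And>b. subst \<phi> (\<psi> b) - var b \<in> relation_ideal T"
  shows "\<exists>f\<in>algebra_iso (presented_algebra S) (presented_algebra T).
    \<forall>a. f (presented_gen S a) = presented_class T (\<phi> a)"
proof -
  \<comment> \<open>The union avoids choosing a representative: once all the classes agree, it
    equals their common value.\<close>
  define f where "f = (\<lambda>U. \<Union>p\<in>U. presented_class T (subst \<phi> p))"
  define g where "g = (\<lambda>U. \<Union>q\<in>U. presented_class S (subst \<psi> q))"
  \<comment> \<open>Stated for arbitrary presentations, so that it serves \<open>f\<close> and
    \<open>g\<close> alike.\<close>
  have lift: "(\<Union>p\<in>presented_class S p. presented_class T (subst \<phi> p)) = presented_class T (subst \<phi> p)"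
    if rel: "\<And>r. r \<in> S \<Longrightarrow> subst \<phi> r \<in> relation_ideal T"
    for S :: "('k::field, 'u) noncomm_poly set" and T :: "('k, 'v) noncomm_poly set" and \<phi> p
  proof -
    have "presented_class T (subst \<phi> q) = presented_class T (subst \<phi> p)"
      if q: "q \<in> presented_class S p" for q
    proof -
      have "q - p \<in> relation_ideal S"
        using q by (auto simp: a_r_coset_def r_coset_def)
      then show ?thesis
        using subst_relation_ideal [OF rel, of S "q - p"]
        by (simp add: presented_class_eq_iff)
    qed
    \<comment> \<open>The coset is nonempty, so the union of equal classes is that class and not the
      empty set.\<close>
    moreover have "p \<in> presented_class S p"
      using relation_ideal_zero [of S] by (force simp: a_r_coset_def r_coset_def)
    ultimately show ?thesis by blast
  qed
  have f: "f (presented_class S p) = presented_class T (subst \<phi> p)" for p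
    unfolding f_def by (rule lift) (rule \<phi>)
  have g: "g (presented_class T q) = presented_class S (subst \<psi> q)" for q
    unfolding g_def by (rule lift) (rule \<psi>)
  have "f \<in> algebra_hom (presented_algebra S) (presented_algebra T)"
    by (auto simp: algebra_hom_def carrier_presented_algebra mult_presented_algebra f
        add_presented_algebra one_presented_algebra smult_presented_algebra smult_free_algebra
        intro!: ring_hom_memI)
  moreover have "bij_betw f (carrier (presented_algebra S)) (carrier (presented_algebra T))"
    by (rule bij_betw_byWitness [where f' = g])
      (auto simp: carrier_presented_algebra f g subst_subst_class \<psi>\<phi> \<phi>\<psi>)
  ultimately have "f \<in> algebra_iso (presented_algebra S) (presented_algebra T)"
    by (simp add: algebra_iso_def)
  moreover have "f (presented_gen S a) = presented_class T (\<phi> a)" for a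
    by (simp add: presented_gen_def f)
  ultimately show ?thesis by blast
qed

section \<open>The substitutions between the two presentations\<close>

theorem lemma2p2:
  shows "\<exists>f \<in> algebra_iso
      (algebra_B :: ('k::{alg_closed_field, field_char_0}, ('k, gen_XY) noncomm_poly set) module)
      (algebra_A :: ('k, ('k, gen_xyz) noncomm_poly set) module).
    f (presented_gen relations_B GX) = presented_gen relations_A Gx \<and>
    f (presented_gen relations_B GY) = presented_gen relations_A Gy"
proof -
  define x y z :: "('k, gen_xyz) noncomm_poly" where xyz: "x = var Gx" "y = var Gy" "z = var Gz"
  define X Y :: "('k, gen_XY) noncomm_poly" where XY: "X = var GX" "Y = var GY"
  define \<phi> where "\<phi> = case_gen_XY x y"
  define \<psi> where "\<psi> = case_gen_xyz X Y (scalar (1/2) * (X * Y + Y * X))"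
  note defs = xyz XY \<phi>_def \<psi>_def
  \<comment> \<open>Characteristic zero enters here: 2 is invertible in \<open>'k\<close>.\<close>
  have half: "2 * (scalar (1/2) * p) = p" for p :: "('k, 'x) noncomm_poly"
    by (simp add: mult_single flip: mult.assoc single_numeral)
  have half': "scalar (1/2) * (2 * p) = p" for p :: "('k, 'x) noncomm_poly"
    by (simp add: mult_single flip: mult.assoc single_numeral)
  \<comment> \<open>Numerals are spelled out as repeated sums, so that expansion leaves plain sums
    of words to compare.\<close>
  have quadruple: "4 * p = p + p + p + p" for p :: "('k, 'x) noncomm_poly"
    by (simp only: numeral_Bit0 numeral_One distrib_right mult_1_left add.assoc)
  have rel_A: "x * y + y * x - 2 * z \<in> relation_ideal relations_A"
      "y * z + z * y - 2 * x \<in> relation_ideal relations_A"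
      "z * x + x * z - 2 * y \<in> relation_ideal relations_A"
    using relation_ideal_self [of relations_A] by (auto simp: relations_A_def xyz Let_def)
  have rel_B: "X\<^sup>2 * Y + 2 * X * Y * X + Y * X\<^sup>2 - 4 * Y \<in> relation_ideal relations_B"
      "Y\<^sup>2 * X + 2 * Y * X * Y + X * Y\<^sup>2 - 4 * X \<in> relation_ideal relations_B"
    using relation_ideal_self [of relations_B] by (auto simp: relations_B_def XY Let_def)
  have "\<exists>f\<in>algebra_iso (presented_algebra relations_B) (presented_algebra relations_A).
    \<forall>a. f (presented_gen relations_B a) = presented_class relations_A (\<phi> a)"
  proof (rule presented_algebra_iso [where \<psi> = \<psi>])
    fix r :: "('k, gen_XY) noncomm_poly"
    assume "r \<in> relations_B"
    then consider "r = X\<^sup>2 * Y + 2 * X * Y * X + Y * X\<^sup>2 - 4 * Y"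
      | "r = Y\<^sup>2 * X + 2 * Y * X * Y + X * Y\<^sup>2 - 4 * X"
      by (auto simp: relations_B_def XY Let_def)
    then show "subst \<phi> r \<in> relation_ideal relations_A"
    proof cases
      case 1
      \<comment> \<open>The anticommutator of \<open>x\<close> with the first relation gives the
        cubic terms and -2(xz + zx); adding twice the third relation trades the latter for
        -4y.\<close>
      have "subst \<phi> r = x * (x * y + y * x - 2 * z) + (x * y + y * x - 2 * z) * x
          + 2 * (z * x + x * z - 2 * y)"
        unfolding 1 by (simp add: defs power2_eq_square)
          (simp only: mult_2 mult_2_right quadruple algebra_simps)
      then show ?thesis
        by (simp only: relation_ideal_add relation_ideal_lmult relation_ideal_rmult rel_A)
    next
      case 2
      \<comment> \<open>Likewise with \<open>y\<close> and the second relation.\<close>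
      have "subst \<phi> r = y * (x * y + y * x - 2 * z) + (x * y + y * x - 2 * z) * y
          + 2 * (y * z + z * y - 2 * x)"
        unfolding 2 by (simp add: defs power2_eq_square)
          (simp only: mult_2 mult_2_right quadruple algebra_simps)
      then show ?thesis
        by (simp only: relation_ideal_add relation_ideal_lmult relation_ideal_rmult rel_A)
    qed
  next
    fix r :: "('k, gen_xyz) noncomm_poly"
    assume "r \<in> relations_A"
    then consider "r = x * y + y * x - 2 * z" | "r = y * z + z * y - 2 * x"
      | "r = z * x + x * z - 2 * y"
      by (auto simp: relations_A_def xyz Let_def)
    then show "subst \<psi> r \<in> relation_ideal relations_B"
    proof cases
      case 1
      \<comment> \<open>By the choice of the image of \<open>z\<close>, this relation becomes 0
        already in the free algebra.\<close>
      then show ?thesis by (simp add: defs half relation_ideal_zero)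
    next
      case 2
      \<comment> \<open>The anticommutator of Y with XY + YX is the cubic part, YXY arising
        twice.\<close>
      have "subst \<psi> r = scalar (1/2) * (Y\<^sup>2 * X + 2 * Y * X * Y + X * Y\<^sup>2 - 4 * X)"
      proof -
        have "scalar (1/2) * (4 * X) = 2 * X"
          using half' [of "2 * X"] by (simp flip: mult.assoc)
        then show ?thesis
          \<comment> \<open>Only the 2 in front of Y is expanded, giving two copies of YXY; 2X stays
            whole to match the preceding equation.\<close>
          unfolding 2 mult_2 [of Y] distrib_right [of Y Y]
          by (simp add: defs power2_eq_square scalar_left_commute algebra_simps)
      qed
      then show ?thesis
        by (simp only: relation_ideal_lmult rel_B)
    next
      case 3
      have "subst \<psi> r = scalar (1/2) * (X\<^sup>2 * Y + 2 * X * Y * X + Y * X\<^sup>2 - 4 * Y)"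
      proof -
        have "scalar (1/2) * (4 * Y) = 2 * Y"
          using half' [of "2 * Y"] by (simp flip: mult.assoc)
        then show ?thesis
          unfolding 3 mult_2 [of X] distrib_right [of X X]
          by (simp add: defs power2_eq_square scalar_left_commute algebra_simps)
      qed
      then show ?thesis
        by (simp only: relation_ideal_lmult rel_B)
    qed
  next
    fix a
    \<comment> \<open>On X and Y the composite is the identity already before passing to the
      quotient.\<close>
    show "subst \<psi> (\<phi> a) - var a \<in> relation_ideal relations_B"
      by (cases a) (simp_all add: defs relation_ideal_zero)
  next
    fix b
    \<comment> \<open>Among the generators only \<open>z\<close> is moved by this composite, by half
      of the first relation.\<close>
    have "scalar (1/2) * (x * y + y * x) - z = scalar (1/2) * (x * y + y * x - 2 * z)"
      by (simp add: right_diff_distrib half')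
    then have "scalar (1/2) * (x * y + y * x) - z \<in> relation_ideal relations_A"
      by (simp only: relation_ideal_lmult rel_A)
    then show "subst \<phi> (\<psi> b) - var b \<in> relation_ideal relations_A"
      by (cases b) (simp_all add: defs relation_ideal_zero)
  qed
  then show ?thesis
    unfolding algebra_A_def algebra_B_def
    by (elim bexE, intro bexI conjI) (simp_all add: defs presented_gen_def)
qed

end
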